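(* Let $G$ be a connected graph with $\mathrm{diam}(G)\geq 4$. If the complement $\overline{G}$ is connected, then $rc(\overline{G})\leq 4$.
   Context: All graphs are finite, undirected and simple. For an edge-coloring $c:E(H)\to\{1,\dots,k\}$ (adjacent edges may receive the same color), a path is rainbow if no two of its edges have the same color; $H$ is rainbow connected under $c$ if every two vertices are joined by a rainbow path. The rainbow connection number $rc(H)$ of a nontrivial connected graph $H$ is the minimum $k$ for which such a coloring with $k$ colors exists. $\mathrm{diam}$ denotes diameter and $\overline{G}$ the complement of $G$. *)

theory Defs
  imports "Graph_Theory.Graph_Theory"
begin

text \<open>
  A finite simple undirected graph is a \<^locale>\<open>pair_graph\<close>: each edge \<open>uv\<close> is represented by the two
  arcs \<open>(u, v)\<close> and \<open>(v, u)\<close>. Colours are attached to the undirected edges \<open>{u, v}\<close>, so both arcs of an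
  edge have the same colour.
\<close>

definition complement :: "'a pair_pre_digraph \<Rightarrow> 'a pair_pre_digraph" where
  "complement G =
    \<lparr> pverts = pverts G,
      parcs = {(u, v). u \<in> pverts G \<and> v \<in> pverts G \<and> u \<noteq> v \<and> (u, v) \<notin> parcs G} \<rparr>"

lemma pair_graph_complement:
  assumes "pair_graph G"
  shows "pair_graph (complement G)"
proof -
  interpret pair_graph G by fact
  have sym: "(u, v) \<in> parcs G \<longleftrightarrow> (v, u) \<in> parcs G" for u v
    using pair_sym_arcs by (auto simp: symmetric_def dest: symD)
  have "finite (pverts G \<times> pverts G)"
    using pair_finite_verts by simp
  then have "finite {(u, v). u \<in> pverts G \<and> v \<in> pverts G \<and> u \<noteq> v \<and> (u, v) \<notin> parcs G}"
    by (rule rev_finite_subset) auto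
  then show ?thesis
    using pair_finite_verts sym
    by unfold_locales (auto simp: complement_def symmetric_def intro!: symI)
qed

text \<open>With unit arc costs, \<^const>\<open>wf_digraph.\<mu>\<close> is the length of a shortest walk, i.e. the distance.\<close>

definition graph_dist :: "'a pair_pre_digraph \<Rightarrow> 'a \<Rightarrow> 'a \<Rightarrow> ereal" where
  "graph_dist G u v = wf_digraph.\<mu> (with_proj G) (\<lambda>_. 1) u v"

definition diam :: "'a pair_pre_digraph \<Rightarrow> ereal" where
  "diam G = (SUP (u, v) \<in> pverts G \<times> pverts G. graph_dist G u v)"

definition edge_of :: "'a \<times> 'a \<Rightarrow> 'a set" where
  "edge_of a = {fst a, snd a}"

definition edges :: "'a pair_pre_digraph \<Rightarrow> 'a set set" where
  "edges G = edge_of ` parcs G"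

definition rainbow_path ::
  "'a pair_pre_digraph \<Rightarrow> ('a set \<Rightarrow> nat) \<Rightarrow> 'a \<Rightarrow> ('a \<times> 'a) awalk \<Rightarrow> 'a \<Rightarrow> bool" where
  "rainbow_path G c u p v \<longleftrightarrow>
     pre_digraph.apath (with_proj G) u p v \<and> distinct (map (\<lambda>a. c (edge_of a)) p)"

definition rainbow_connected :: "'a pair_pre_digraph \<Rightarrow> ('a set \<Rightarrow> nat) \<Rightarrow> bool" where
  "rainbow_connected G c \<longleftrightarrow>
     (\<forall>u \<in> pverts G. \<forall>v \<in> pverts G. u \<noteq> v \<longrightarrow> (\<exists>p. rainbow_path G c u p v))"

definition rc :: "'a pair_pre_digraph \<Rightarrow> nat" where
  "rc G = (LEAST k. \<exists>c. c ` edges G \<subseteq> {1..k} \<and> rainbow_connected G c)"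

text \<open>The minimum is over a nonempty set: colour the edges injectively.\<close>

lemma rc_attained:
  assumes "pair_graph G" and "Digraph_Component.connected (with_proj G)"
  shows "\<exists>c. c ` edges G \<subseteq> {1..rc G} \<and> rainbow_connected G c"
proof -
  interpret pair_graph G by fact
  have fin: "finite (edges G)"
    by (simp add: edges_def pair_finite_arcs)
  then obtain f :: "'a set \<Rightarrow> nat" where f: "bij_betw f (edges G) {0..<card (edges G)}"
    using ex_bij_betw_finite_nat by blast
  define c where "c e = Suc (f e)" for e
  have "c ` edges G \<subseteq> {1..card (edges G)}"
    using bij_betwE[OF f] by (fastforce simp: c_def)
  moreover have "rainbow_connected G c"
    unfolding rainbow_connected_def
  proof (intro ballI impI)
    fix u v assume uv: "u \<in> pverts G" "v \<in> pverts G"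
    have "strongly_connected (with_proj G)"
      using assms(2) pair_sym_arcs by (rule symmetric_connected_imp_strongly_connected[rotated])
    with uv have "u \<rightarrow>\<^sup>*\<^bsub>with_proj G\<^esub> v"
      by (simp add: strongly_connected_def)
    then obtain p where p: "apath u p v"
      using reachable_apath by blast
    have inj: "x = y" if "x \<in> set q" "y \<in> set q" "edge_of x = edge_of y" "apath w q v" for x y q w
      using that
    proof (induction q arbitrary: w)
      case (Cons a q)
      have a: "fst a = w" and q: "apath (snd a) q v" and w: "w \<notin> set (pawalk_verts (snd a) q)"
        using Cons.prems(4) by (auto simp: apath_Cons_iff)
      have ne: "edge_of b \<noteq> edge_of a" if "b \<in> set q" for b
      proof
        have "fst b \<in> set (pawalk_verts (snd a) q)"
          using awalk_verts_arc1[OF that] by simp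
        moreover have "snd b \<in> set (pawalk_verts (snd a) q)"
          using awalk_verts_arc2[OF awalkI_apath[OF q] that] by simp
        moreover assume "edge_of b = edge_of a"
        then have "w = fst b \<or> w = snd b"
          using a by (auto simp: edge_of_def doubleton_eq_iff)
        ultimately show False
          using w by auto
      qed
      consider "x = a" "y = a" | "x = a" "y \<in> set q" | "x \<in> set q" "y = a" | "x \<in> set q" "y \<in> set q"
        using Cons.prems(1,2) by auto
      then show ?case
        by cases (use Cons.prems(3) ne[of x] ne[of y] Cons.IH[OF _ _ _ q] in simp_all)
    qed simp
    have e: "edge_of a \<in> edges G" if "a \<in> set p" for a
      using p that by (auto simp: apath_def awalk_def edges_def)
    have "inj_on (\<lambda>a. c (edge_of a)) (set p)"
    proof (rule inj_onI)
      fix x y assume xy: "x \<in> set p" "y \<in> set p" "c (edge_of x) = c (edge_of y)"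
      then have "edge_of x = edge_of y"
        using inj_onD[OF bij_betw_imp_inj_on[OF f]] e by (simp add: c_def)
      then show "x = y"
        using inj xy(1,2) p by simp
    qed
    moreover have "distinct p"
      using p distinct_verts_imp_distinct[of u p v] by (simp add: apath_def)
    ultimately have "rainbow_path G c u p v"
      using p by (simp add: rainbow_path_def distinct_map)
    then show "\<exists>p. rainbow_path G c u p v" ..
  qed
  ultimately have "\<exists>k c. c ` edges G \<subseteq> {1..k} \<and> rainbow_connected G c"
    by blast
  then show ?thesis
    unfolding rc_def by (rule LeastI_ex)
qed

end

theory Submission
  imports Defs
begin

text \<open>
  Let \<open>x\<close> be an end of a geodesic of length at least 4 in \<open>G\<close> and let \<open>L\<^sub>0 = {x}, L\<^sub>1, \<dots>, L\<^sub>4\<close> be the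
  distance layers around \<open>x\<close>, all vertices at distance at least 4 being put into \<open>L\<^sub>4\<close>. In the
  complement, two layers whose indices differ by at least 2 are completely joined. Give the joins of
  the cycle \<open>L\<^sub>1 L\<^sub>3 L\<^sub>0 L\<^sub>4 L\<^sub>1\<close> the four colours 1, 2, 3, 4 in this order: going once around this cycle
  connects two vertices of the same layer \<open>L\<^sub>1\<close>, \<open>L\<^sub>3\<close> or \<open>L\<^sub>4\<close>. With colour 4 on \<open>L\<^sub>0 L\<^sub>2\<close> and colour 1
  on \<open>L\<^sub>2 L\<^sub>4\<close>, the closed walk \<open>L\<^sub>2 L\<^sub>0 L\<^sub>4 L\<^sub>2\<close> does the same for \<open>L\<^sub>2\<close>, and consecutive layers are
  joined by rainbow paths of length 2.
\<close>

definition layer_colour :: "('a \<Rightarrow> nat) \<Rightarrow> 'a set \<Rightarrow> nat" where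
  "layer_colour l e =
     (if l ` e = {0, 3} then 2
      else if l ` e = {0, 4} then 3
      else if l ` e = {1, 4} \<or> l ` e = {0, 2} then 4
      else 1)"

lemma rc_leI:
  assumes "c ` edges G \<subseteq> {1..k}" and "rainbow_connected G c"
  shows "rc G \<le> k"
  unfolding rc_def using assms by (intro Least_le) blast

text \<open>Separates the colouring from the choice of \<open>l\<close>. Every edge travelled comes
  from \<open>joined\<close>, and \<open>x0\<close>, \<open>x1\<close>, \<open>x3\<close>,
  \<open>x4\<close> serve as intermediate vertices. Edges inside a layer or between consecutive
  layers get the default colour 1 and are never travelled.\<close>

lemma rc_le_4_if_layered:
  fixes l :: "'a \<Rightarrow> nat"
  assumes "pair_graph H"
    and le4: "\<And>v. v \<in> pverts H \<Longrightarrow> l v \<le> 4"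
    and inhabited: "\<And>i. i \<le> 4 \<Longrightarrow> \<exists>v \<in> pverts H. l v = i"
    and root: "\<And>u v. u \<in> pverts H \<Longrightarrow> v \<in> pverts H \<Longrightarrow> l u = 0 \<Longrightarrow> l v = 0 \<Longrightarrow> u = v"
    and joined: "\<And>u v. u \<in> pverts H \<Longrightarrow> v \<in> pverts H \<Longrightarrow> l u + 2 \<le> l v \<Longrightarrow>
      (u, v) \<in> parcs H \<and> (v, u) \<in> parcs H"
  shows "rc H \<le> 4"
proof (rule rc_leI)
  interpret pair_graph H by fact
  let ?c = "layer_colour l"
  show "?c ` edges H \<subseteq> {1..4}"
    by (auto simp: layer_colour_def)
  obtain x0 where x0: "x0 \<in> pverts H" "l x0 = 0" using inhabited[of 0] by auto
  obtain x1 where x1: "x1 \<in> pverts H" "l x1 = 1" using inhabited[of 1] by auto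
  obtain x3 where x3: "x3 \<in> pverts H" "l x3 = 3" using inhabited[of 3] by auto
  obtain x4 where x4: "x4 \<in> pverts H" "l x4 = 4" using inhabited[of 4] by auto
  have path1: "\<exists>p. rainbow_path H ?c u p v"
    if "(u, v) \<in> parcs H" "u \<noteq> v" for u v
    using that
    by (intro exI[of _ "[(u, v)]"])
       (auto simp: rainbow_path_def apath_Cons_iff apath_Nil_iff dest: wellformed)
  have path2: "\<exists>p. rainbow_path H ?c u p v"
    if "(u, a) \<in> parcs H" "(a, v) \<in> parcs H" "distinct [l u, l a, l v]"
      "distinct [?c {u, a}, ?c {a, v}]" for u a v
    using that
    by (intro exI[of _ "[(u, a), (a, v)]"])
       (auto simp: rainbow_path_def apath_Cons_iff apath_Nil_iff edge_of_def dest: wellformed)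
  have path3: "\<exists>p. rainbow_path H ?c u p v"
    if "(u, a) \<in> parcs H" "(a, b) \<in> parcs H" "(b, v) \<in> parcs H" "distinct [l u, l a, l b]"
      "l v = l u" "u \<noteq> v"
      "distinct [?c {u, a}, ?c {a, b}, ?c {b, v}]" for u a b v
  proof -
    \<comment> \<open>The inner vertices avoid the layer shared by \<open>u\<close> and
      \<open>v\<close>, so beyond the distinct layers only \<open>u \<noteq> v\<close> is
      needed.\<close>
    have "distinct [u, a, b, v]"
      using that by auto
    moreover have "v \<in> pverts H"
      using that(3) by (auto dest: wellformed)
    ultimately show ?thesis
      using that
      by (intro exI[of _ "[(u, a), (a, b), (b, v)]"])
         (simp add: rainbow_path_def apath_Cons_iff apath_Nil_iff edge_of_def)
  qed
  have path4: "\<exists>p. rainbow_path H ?c u p v"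
    if "(u, a) \<in> parcs H" "(a, b) \<in> parcs H" "(b, d) \<in> parcs H" "(d, v) \<in> parcs H"
      "distinct [l u, l a, l b, l d]" "l v = l u" "u \<noteq> v"
      "distinct [?c {u, a}, ?c {a, b}, ?c {b, d}, ?c {d, v}]" for u a b d v
  proof -
    have "distinct [u, a, b, d, v]"
      using that by auto
    moreover have "v \<in> pverts H"
      using that(4) by (auto dest: wellformed)
    ultimately show ?thesis
      using that
      by (intro exI[of _ "[(u, a), (a, b), (b, d), (d, v)]"])
         (simp add: rainbow_path_def apath_Cons_iff apath_Nil_iff edge_of_def)
  qed
  show "rainbow_connected H ?c"
    unfolding rainbow_connected_def
  proof (intro ballI impI)
    fix u v assume u: "u \<in> pverts H" and v: "v \<in> pverts H" and ne: "u \<noteq> v"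
    note layers = x0 x1 x3 x4 u v ne joined layer_colour_def doubleton_eq_iff
    have "l u \<in> {0, 1, 2, 3, 4}" "l v \<in> {0, 1, 2, 3, 4}"
      using le4[OF u] le4[OF v] by auto
    then consider
        "l u + 2 \<le> l v \<or> l v + 2 \<le> l u"
      | "l u = 0" "l v = 0"
      | "l u = 1" "l v = 1" | "l u = 2" "l v = 2" | "l u = 3" "l v = 3" | "l u = 4" "l v = 4"
      | "l u = 0" "l v = 1" | "l u = 1" "l v = 0" | "l u = 1" "l v = 2" | "l u = 2" "l v = 1"
      | "l u = 2" "l v = 3" | "l u = 3" "l v = 2" | "l u = 3" "l v = 4" | "l u = 4" "l v = 3"
      by (elim insertE emptyE; simp)
    then show "\<exists>p. rainbow_path H ?c u p v"
    proof cases
      case 1 then show ?thesis using path1 joined u v ne by blast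
    next
      case 2 then show ?thesis using root u v ne by blast
    next
      case 3 show ?thesis by (rule path4[of u x3 x0 x4 v]) (simp_all add: 3 layers)
    next
      case 4 show ?thesis by (rule path3[of u x0 x4 v]) (simp_all add: 4 layers)
    next
      case 5 show ?thesis by (rule path4[of u x0 x4 x1 v]) (simp_all add: 5 layers)
    next
      case 6 show ?thesis by (rule path4[of u x1 x3 x0 v]) (simp_all add: 6 layers)
    next
      \<comment> \<open>For consecutive layers the midpoint must be at least 2 layers away from both
        ends: \<open>x3\<close> for 0 and 1, \<open>x4\<close> for 1 and 2, \<open>x0\<close> for
        the others. The colour pairs from the lower layer are 2,1; 4,1; 4,2; 2,3.\<close>
      case 7 show ?thesis by (rule path2[of u x3 v]) (simp_all add: 7 layers)
    next
      case 8 show ?thesis by (rule path2[of u x3 v]) (simp_all add: 8 layers)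
    next
      case 9 show ?thesis by (rule path2[of u x4 v]) (simp_all add: 9 layers)
    next
      case 10 show ?thesis by (rule path2[of u x4 v]) (simp_all add: 10 layers)
    next
      case 11 show ?thesis by (rule path2[of u x0 v]) (simp_all add: 11 layers)
    next
      case 12 show ?thesis by (rule path2[of u x0 v]) (simp_all add: 12 layers)
    next
      case 13 show ?thesis by (rule path2[of u x0 v]) (simp_all add: 13 layers)
    next
      case 14 show ?thesis by (rule path2[of u x0 v]) (simp_all add: 14 layers)
    qed
  qed
qed

text \<open>A natural-number distance, suited to layers and induction, unlike the
  \<open>ereal\<close> valued \<open>graph_dist\<close>. For unreachable \<open>v\<close> the value
  is unspecified, hence the reachability hypotheses below.\<close>

definition walk_dist :: "'a rel \<Rightarrow> 'a \<Rightarrow> 'a \<Rightarrow> nat" where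
  "walk_dist r x v = (LEAST n. (x, v) \<in> r ^^ n)"

lemma walk_dist_le: "(x, v) \<in> r ^^ n \<Longrightarrow> walk_dist r x v \<le> n"
  unfolding walk_dist_def by (rule Least_le)

lemma walk_dist_attained:
  assumes "(x, v) \<in> r\<^sup>*"
  shows "(x, v) \<in> r ^^ walk_dist r x v"
  unfolding walk_dist_def using assms by (auto simp: rtrancl_power intro: LeastI)

lemma walk_dist_self [simp]: "walk_dist r x x = 0"
  using walk_dist_le[of x x 0 r] by simp

lemma walk_dist_eq_0_iff:
  assumes "(x, v) \<in> r\<^sup>*"
  shows "walk_dist r x v = 0 \<longleftrightarrow> v = x"
  using walk_dist_attained[OF assms] by auto

text \<open>Append the arc to a shortest walk. Contrapositively, layers at least 2 apart have no arc
  between them, which makes them joined in the complement.\<close>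

lemma walk_dist_step:
  assumes "(x, v) \<in> r\<^sup>*" and "(v, w) \<in> r"
  shows "walk_dist r x w \<le> Suc (walk_dist r x v)"
  by (rule walk_dist_le) (use walk_dist_attained[OF assms(1)] assms(2) in auto)

text \<open>Take the last but one vertex of a shortest walk; were it nearer to \<open>x\<close> than
  \<open>n\<close>, then \<open>v\<close> would be nearer too.\<close>

lemma walk_dist_pred:
  assumes "(x, v) \<in> r\<^sup>*" and "walk_dist r x v = Suc n"
  shows "\<exists>w. (x, w) \<in> r\<^sup>* \<and> (w, v) \<in> r \<and> walk_dist r x w = n"
proof -
  have "(x, v) \<in> r ^^ Suc n"
    using walk_dist_attained[OF assms(1)] assms(2) by simp
  then obtain w where w: "(x, w) \<in> r ^^ n" "(w, v) \<in> r"
    by auto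
  then have xw: "(x, w) \<in> r\<^sup>*"
    by (auto simp: rtrancl_power)
  then have "walk_dist r x w = n"
    using walk_dist_step[OF xw w(2)] walk_dist_le[OF w(1)] assms(2) by simp
  with xw w(2) show ?thesis by blast
qed

text \<open>Descending from \<open>v\<close> by predecessors meets every smaller distance, so no
  layer up to that of \<open>v\<close> is empty.\<close>

lemma walk_dist_onto:
  assumes "(x, v) \<in> r\<^sup>*" and "i \<le> walk_dist r x v"
  shows "\<exists>w. (x, w) \<in> r\<^sup>* \<and> walk_dist r x w = i"
  using assms
proof (induction "walk_dist r x v" arbitrary: v)
  case 0
  then show ?case by auto
next
  case (Suc n)
  show ?case
  proof (cases "i = Suc n")
    case True
    with Suc show ?thesis by auto
  next
    case False
    obtain w where "(x, w) \<in> r\<^sup>*" "walk_dist r x w = n"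
      using walk_dist_pred[OF Suc.prems(1)] Suc.hyps(2) by metis
    with False Suc show ?thesis by auto
  qed
qed

lemma (in pair_graph) relpow_awalk:
  assumes "(u, v) \<in> parcs G ^^ n" and "u \<in> pverts G"
  shows "\<exists>p. awalk u p v \<and> length p = n"
  using assms
proof (induction n arbitrary: v)
  case 0
  then show ?case by (auto simp: awalk_Nil_iff intro!: exI[of _ "[]"])
next
  case (Suc n)
  then obtain w p where w: "(w, v) \<in> parcs G" "awalk u p w" "length p = n"
    by (meson relpow_Suc_E)
  then have "awalk w [(w, v)] v"
    by (auto simp: awalk_Cons_iff awalk_Nil_iff dest: wellformed)
  with w have "awalk u (p @ [(w, v)]) v"
    by (auto intro: awalk_appendI)
  with w(3) show ?case
    by (metis length_append_singleton)
qed

text \<open>Turns a lower bound on \<open>graph_dist\<close> into one on \<open>walk_dist\<close>: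
  with unit costs, a walk of \<open>n\<close> arcs costs \<open>n\<close>.\<close>

lemma (in pair_graph) graph_dist_le:
  assumes "(u, v) \<in> parcs G ^^ n" and "u \<in> pverts G"
  shows "graph_dist G u v \<le> real n"
proof -
  obtain p where p: "awalk u p v" "length p = n"
    using relpow_awalk[OF assms] by blast
  have "awalk_cost (\<lambda>_. 1) p = real (length p)"
    by (induction p) auto
  with min_cost_le_walk_cost[OF p(1), of "\<lambda>_. 1"] p(2) show ?thesis
    by (simp add: graph_dist_def)
qed

lemma (in pair_graph) rtrancl_arcs_if_connected:
  assumes "Digraph_Component.connected (with_proj G)" and "u \<in> pverts G" and "v \<in> pverts G"
  shows "(u, v) \<in> (parcs G)\<^sup>*"
proof -
  have "strongly_connected (with_proj G)"
    using assms(1) pair_sym_arcs by (rule symmetric_connected_imp_strongly_connected[rotated])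
  with assms(2,3) have "u \<rightarrow>\<^sup>*\<^bsub>with_proj G\<^esub> v"
    by (simp add: strongly_connected_def)
  then show ?thesis
    by (auto simp: reachable_def dest: rtrancl_on_rtranclI)
qed

text \<open>A supremum over a finite nonempty set is a maximum, so a large diameter yields an actual
  distant pair.\<close>

lemma diam_attained:
  assumes "finite (pverts G)" and "pverts G \<noteq> {}"
  shows "\<exists>u \<in> pverts G. \<exists>v \<in> pverts G. diam G = graph_dist G u v"
proof -
  let ?D = "(\<lambda>(u, v). graph_dist G u v) ` (pverts G \<times> pverts G)"
  have D: "finite ?D" "?D \<noteq> {}"
    using assms by auto
  then have "diam G = Max ?D"
    by (simp add: diam_def Max_Sup)
  also have "\<dots> \<in> ?D"
    using D by (rule Max_in)
  finally show ?thesis by auto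
qed

theorem theorem3p1:
  fixes G :: "'a pair_pre_digraph"
  assumes "pair_graph G"
    and "Digraph_Component.connected (with_proj G)"
    and "diam G \<ge> 4"
    and "Digraph_Component.connected (with_proj (complement G))"
  shows "rc (complement G) \<le> 4"
proof -
  interpret pair_graph G by fact
  \<comment> \<open>The supremum over no pairs is -\<infinity>, which is below 4.\<close>
  have "pverts G \<noteq> {}"
    using assms(3) by (auto simp: diam_def bot_ereal_def)
  then obtain x y where x: "x \<in> pverts G" and y: "y \<in> pverts G" and far: "graph_dist G x y \<ge> 4"
    using diam_attained pair_finite_verts assms(3) by metis
  have reach: "(x, v) \<in> (parcs G)\<^sup>*" if "v \<in> pverts G" for v
    using rtrancl_arcs_if_connected[OF assms(2) x that] .
  have in_verts: "v \<in> pverts G" if "(x, v) \<in> (parcs G)\<^sup>*" for v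
    using that x by induction (auto dest: wellformed)
  let ?d = "walk_dist (parcs G) x"
  let ?l = "\<lambda>v. min 4 (?d v)"
  have "ereal 4 \<le> ereal (real (?d y))"
    using order_trans[OF far graph_dist_le[OF walk_dist_attained[OF reach[OF y]] x]] by simp
  then have dy: "4 \<le> ?d y"
    by simp
  show ?thesis
  proof (rule rc_le_4_if_layered[where l = ?l])
    show "pair_graph (complement G)"
      using assms(1) by (rule pair_graph_complement)
  next
    fix i :: nat assume i: "i \<le> 4"
    then obtain v where "(x, v) \<in> (parcs G)\<^sup>*" "?d v = i"
      using walk_dist_onto[OF reach[OF y]] dy by (meson order_trans)
    with i in_verts show "\<exists>v \<in> pverts (complement G). ?l v = i"
      by (auto simp: complement_def intro!: bexI[of _ v])
  next
    fix u v assume "u \<in> pverts (complement G)" "v \<in> pverts (complement G)" "?l u = 0" "?l v = 0"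
    then have "u \<in> pverts G" "v \<in> pverts G" "?d u = 0" "?d v = 0"
      by (auto simp: complement_def min_def split: if_splits)
    then show "u = v"
      using walk_dist_eq_0_iff[OF reach] by metis
  next
    fix u v assume "u \<in> pverts (complement G)" "v \<in> pverts (complement G)" and l: "?l u + 2 \<le> ?l v"
    then have uv: "u \<in> pverts G" "v \<in> pverts G"
      by (auto simp: complement_def)
    \<comment> \<open>Truncation at 4 is harmless: here \<open>?l u \<le> 2\<close>, so
      \<open>?l u = ?d u\<close>, while \<open>?l v \<le> ?d v\<close>; thus \<open>?d v\<close>
      exceeds \<open>?d u\<close> by at least 2.\<close>
    have "(u, v) \<notin> parcs G"
      using walk_dist_step[OF reach[OF uv(1)], of v] l by auto
    moreover from this have "(v, u) \<notin> parcs G"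
      using pair_sym_arcs by (auto simp: symmetric_def dest: symD)
    ultimately show "(u, v) \<in> parcs (complement G) \<and> (v, u) \<in> parcs (complement G)"
      using uv l by (auto simp: complement_def)
  qed simp
qed

end
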